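(* For nonnegative integers $n$ and $k$, let $a_{n,k}^{(3)}$ denote the number of integer points $(x_1,x_2,x_3)\in\mathbb{Z}^3$ such that $\max_{1\leq i\leq 3}|x_i|\leq k$ and $|x_1|+|x_2|+|x_3|\leq n$. Then \[a_{n,k}^{(3)}=\frac13\begin{cases} 4n^3+6n^2+8n+3, & \text{if } 0\leq n<k;\\ 12k^3-36k^2n+36kn^2-8n^3+6n^2+6k+2n+3, & \text{if } k\leq n<2k;\\ -84k^3+108k^2n-36kn^2+4n^3-72k^2+72nk-12n^2-6k+8n+3, & \text{if } 2k\leq n<3k;\\ 24k^3+36k^2+18k+3, & \text{otherwise}. \end{cases}\] *)

theory Defs
  imports Complex_Main
begin

definition lattice_points :: "nat \<Rightarrow> nat \<Rightarrow> (int \<times> int \<times> int) set" where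
  "lattice_points n k =
     {(x1, x2, x3). Max {\<bar>x1\<bar>, \<bar>x2\<bar>, \<bar>x3\<bar>} \<le> int k \<and> \<bar>x1\<bar> + \<bar>x2\<bar> + \<bar>x3\<bar> \<le> int n}"

definition a3 :: "nat \<Rightarrow> nat \<Rightarrow> nat" where
  "a3 n k = card (lattice_points n k)"

text \<open>\<^const>\<open>card\<close> is \<open>0\<close> on infinite sets; the following shows that
  \<^const>\<open>a3\<close> is a genuine count.\<close>

lemma finite_lattice_points: "finite (lattice_points n k)"
proof (rule finite_subset)
  show "lattice_points n k \<subseteq> {- int n..int n} \<times> {- int n..int n} \<times> {- int n..int n}"
    unfolding lattice_points_def by auto
qed simp

end

theory Submission
  imports Defs
begin

text \<open>
  Fix one coordinate \<open>x\<close> at a time: with \<open>f m\<close> the number of points of the \<open>d\<close>-dimensional cube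
  with \<open>1\<close>-norm at most \<open>m\<close>, the number in dimension \<open>d + 1\<close> is
  \<open>g m = (\<Sum>x=-k..k. f (m - \<bar>x\<bar>))\<close>. Telescoping gives
  \<open>g (m + 1) - g m = f (m + 1) + f m - 2 * f (m - k)\<close>, and the closed forms in dimensions two
  and three follow by induction on \<open>m\<close>.
\<close>

definition slice_sum :: "nat \<Rightarrow> (int \<Rightarrow> int) \<Rightarrow> int \<Rightarrow> int" where
  "slice_sum k f m = (\<Sum>x\<in>{- int k..int k}. f (m - \<bar>x\<bar>))"

lemma slice_sum_0: "slice_sum 0 f m = f m"
  by (simp add: slice_sum_def)

lemma slice_sum_Suc:
  "slice_sum (Suc k) f m = slice_sum k f m + 2 * f (m - int (Suc k))"
proof -
  have "{- int (Suc k)..int (Suc k)} =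
      insert (int (Suc k)) (insert (- int (Suc k)) {- int k..int k})"
    by auto
  then show ?thesis
    by (simp add: slice_sum_def algebra_simps del: of_nat_Suc)
qed

text \<open>Passing from \<open>k\<close> to \<open>Suc k\<close> adds 2 * (f (m - k) - f (m - k -
  1)) to the increment, which only moves the boundary term one place down. Hence induction on
  \<open>k\<close> works for arbitrary \<open>f\<close>.\<close>

lemma slice_sum_step:
  "slice_sum k f (m + 1) = slice_sum k f m + f (m + 1) + f m - 2 * f (m - int k)"
  by (induction k) (simp_all add: slice_sum_0 slice_sum_Suc algebra_simps)

lemma slice_sum_neg:
  assumes "\<And>i. i < 0 \<Longrightarrow> f i = 0" and "m < 0"
  shows "slice_sum k f m = 0"
  unfolding slice_sum_def using assms by (intro sum.neutral) auto

lemma slice_sum_at_0: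
  assumes "\<And>i. i < 0 \<Longrightarrow> f i = 0"
  shows "slice_sum k f 0 = f 0"
  by (induction k) (simp_all add: slice_sum_0 slice_sum_Suc assms)

text \<open>The value 0 for negative \<open>m\<close> stands for slices whose fixed coordinates
  already exceed the norm bound.\<close>

definition count1 :: "nat \<Rightarrow> int \<Rightarrow> int" where
  "count1 k m = (if m < 0 then 0 else if m < int k then 2 * m + 1 else 2 * int k + 1)"

text \<open>The branch \<open>m < 2 * int k\<close> removes four corner triangles from the square;
  with t = 2k - m, each has t (t + 1) / 2 points.\<close>

definition count2 :: "nat \<Rightarrow> int \<Rightarrow> int" where
  "count2 k m =
    (if m < 0 then 0
     else if m < int k then 2 * m ^ 2 + 2 * m + 1
     else if m < 2 * int k then (2 * int k + 1) ^ 2 - 2 * (2 * int k - m) * (2 * int k - m + 1)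
     else (2 * int k + 1) ^ 2)"

text \<open>Scaled by three to have integer coefficients. This count is not sliced again, so it is
  evaluated only at nonnegative \<open>m\<close>.\<close>

definition triple_count3 :: "nat \<Rightarrow> int \<Rightarrow> int" where
  "triple_count3 k m = (let K = int k in
    if m < K then
      4 * m ^ 3 + 6 * m ^ 2 + 8 * m + 3
    else if m < 2 * K then
      12 * K ^ 3 - 36 * K ^ 2 * m + 36 * K * m ^ 2 - 8 * m ^ 3 + 6 * m ^ 2 + 6 * K + 2 * m + 3
    else if m < 3 * K then
      - 84 * K ^ 3 + 108 * K ^ 2 * m - 36 * K * m ^ 2 + 4 * m ^ 3 - 72 * K ^ 2 + 72 * m * K
        - 12 * m ^ 2 - 6 * K + 8 * m + 3
    else
      24 * K ^ 3 + 36 * K ^ 2 + 18 * K + 3)"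

lemma count2_step:
  assumes "0 \<le> m"
  shows "count2 k (m + 1) = count2 k m + count1 k (m + 1) + count1 k m - 2 * count1 k (m - int k)"
proof -
  \<comment> \<open>The values k - 1 and 2k - 1 are split off because there \<open>m\<close> and
    \<open>m + 1\<close> lie in different branches.\<close>
  consider "m + 1 < int k" | "int k = m + 1" | "int k \<le> m" "m + 1 < 2 * int k"
    | "m = 2 * int k - 1" "int k \<le> m" | "2 * int k \<le> m"
    by linarith
  then show ?thesis
    using assms
    by cases (auto simp: count1_def count2_def; simp add: power2_eq_square algebra_simps)+
qed

text \<open>The shifted term \<open>count2 k (m - int k)\<close> changes branch at k, 2k and 3k,
  exactly where \<open>triple_count3\<close> does, so each case is a polynomial identity.\<close>

lemma triple_count3_step:
  assumes "0 \<le> m"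
  shows "triple_count3 k (m + 1) =
    triple_count3 k m + 3 * (count2 k (m + 1) + count2 k m - 2 * count2 k (m - int k))"
proof -
  consider "m + 1 < int k" | "int k = m + 1" | "int k \<le> m" "m + 1 < 2 * int k"
    | "m = 2 * int k - 1" "int k \<le> m" | "2 * int k \<le> m" "m + 1 < 3 * int k"
    | "m = 3 * int k - 1" "2 * int k \<le> m" | "3 * int k \<le> m"
    by linarith
  then show ?thesis
    using assms
    by cases (auto simp: triple_count3_def count2_def Let_def;
        simp add: power2_eq_square power3_eq_cube algebra_simps)+
qed

text \<open>Negative \<open>m\<close> is included because the identity is later needed at
  \<open>int n - \<bar>x\<bar>\<close>.\<close>

lemma slice_sum_count1: "slice_sum k (count1 k) m = count2 k m"
proof (cases "m < 0")
  case True
  then show ?thesis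
    by (simp add: slice_sum_neg count1_def count2_def)
next
  case False
  then have "0 \<le> m" by simp
  then show ?thesis
  proof (induction m rule: int_ge_induct)
    case base
    then show ?case
      by (subst slice_sum_at_0) (auto simp: count1_def count2_def)
  next
    case (step m)
    then show ?case
      by (simp add: slice_sum_step count2_step)
  qed
qed

lemma slice_sum_count2:
  assumes "0 \<le> m"
  shows "3 * slice_sum k (count2 k) m = triple_count3 k m"
  using assms
proof (induction m rule: int_ge_induct)
  case base
  then show ?case
    by (subst slice_sum_at_0) (auto simp: count2_def triple_count3_def)
next
  case (step m)
  then show ?case
    by (simp add: slice_sum_step triple_count3_step)
qed

text \<open>The outer coordinates range over the whole cube, as in \<open>slice_sum\<close>; where
  the norm bound is exceeded the fibre is empty.\<close>

lemma lattice_points_eq_Sigma: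
  "lattice_points n k =
    (SIGMA x:{- int k..int k}. SIGMA y:{- int k..int k}.
       {z. \<bar>z\<bar> \<le> int k \<and> \<bar>z\<bar> \<le> int n - \<bar>x\<bar> - \<bar>y\<bar>})"
  by (auto simp: lattice_points_def)

lemma interval_eq:
  "{z. \<bar>z\<bar> \<le> int k \<and> \<bar>z\<bar> \<le> m} = {- min (int k) m..min (int k) m}"
  by auto

lemma card_interval: "int (card {z. \<bar>z\<bar> \<le> int k \<and> \<bar>z\<bar> \<le> m}) = count1 k m"
  by (auto simp: interval_eq count1_def min_def)

lemma a3_eq_slice_sum: "int (a3 n k) = slice_sum k (count2 k) (int n)"
proof -
  define I where "I m = {z. \<bar>z\<bar> \<le> int k \<and> \<bar>z\<bar> \<le> m}" for m
  define D where "D m = (SIGMA y:{- int k..int k}. I (m - \<bar>y\<bar>))" for m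
  have fin_I: "finite (I m)" for m
    by (simp add: I_def interval_eq)
  have card_I: "int (card (I m)) = count1 k m" for m
    by (simp add: I_def card_interval)
  have fin_D: "finite (D m)" for m
    by (simp add: D_def fin_I)
  have card_D: "int (card (D m)) = count2 k m" for m
    \<comment> \<open>The reversed equations bring both sides to
      \<open>slice_sum k (count1 k) m\<close>.\<close>
    by (simp add: D_def fin_I card_I flip: slice_sum_count1 slice_sum_def)
  have "lattice_points n k = (SIGMA x:{- int k..int k}. D (int n - \<bar>x\<bar>))"
    by (simp add: lattice_points_eq_Sigma D_def I_def)
  then show ?thesis
    by (simp add: a3_def fin_D card_D slice_sum_def)
qed

theorem corollary5:
  fixes n k :: nat
  defines "N \<equiv> real n" and "K \<equiv> real k"
  shows "real (a3 n k) = 1 / 3 *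
    (if n < k then
       4 * N ^ 3 + 6 * N ^ 2 + 8 * N + 3
     else if k \<le> n \<and> n < 2 * k then
       12 * K ^ 3 - 36 * K ^ 2 * N + 36 * K * N ^ 2 - 8 * N ^ 3 + 6 * N ^ 2 + 6 * K + 2 * N + 3
     else if 2 * k \<le> n \<and> n < 3 * k then
       - 84 * K ^ 3 + 108 * K ^ 2 * N - 36 * K * N ^ 2 + 4 * N ^ 3 - 72 * K ^ 2 + 72 * N * K
         - 12 * N ^ 2 - 6 * K + 8 * N + 3
     else
       24 * K ^ 3 + 36 * K ^ 2 + 18 * K + 3)"
proof -
  have "3 * int (a3 n k) = triple_count3 k (int n)"
    by (simp add: a3_eq_slice_sum slice_sum_count2)
  then have "real (a3 n k) = 1 / 3 * real_of_int (triple_count3 k (int n))"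
    by linarith
  then show ?thesis
    by (simp add: triple_count3_def N_def K_def Let_def)
qed

end
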